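(* Let $n \ge 4$ be an even integer and let $G$ be a finite solvable group whose character degree graph $\Delta(G)$ has exactly $n$ vertices and is $(n-2)$-regular. Then the distance Laplacian spectrum of $\Delta(G)$ is $$\begin{pmatrix} 0 & n+2 & n\\ 1 & \frac n2 & \frac n2-1\end{pmatrix}.$$
   Context: For a finite group $G$, $\mathrm{Irr}(G)$ is the set of complex irreducible characters of $G$, $\mathrm{cd}(G)=\{\chi(1) : \chi\in \mathrm{Irr}(G)\}$, and $\rho(G)$ is the set of primes dividing some element of $\mathrm{cd}(G)$. The character degree graph $\Delta(G)$ is the simple undirected graph with vertex set $\rho(G)$ in which distinct primes $p,q$ are adjacent if and only if $pq$ divides some $r\in \mathrm{cd}(G)$. For a connected finite simple graph $\Gamma$ with distance matrix $\mathcal D(\Gamma)=(d_{uv})$, the transmission of a vertex $v$ is $\mathrm{Tr}(v)=\sum_{u} d_{uv}$, and the distance Laplacian is $\mathcal D^L(\Gamma)=\mathrm{Tr}(\Gamma)-\mathcal D(\Gamma)$, where $\mathrm{Tr}(\Gamma)$ is the diagonal matrix of transmissions. The distance Laplacian spectrum is the spectrum of $\mathcal D^L(\Gamma)$, displayed as a two-row array with eigenvalues in the first row and their multiplicities in the second row. *)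

theory Defs
  imports
    "HOL-Computational_Algebra.Primes"
    "HOL-Algebra.Solvable_Groups"
    "Jordan_Normal_Form.VS_Connect"
    "Jordan_Normal_Form.Spectral_Radius"
    "Graph_Theory.Graph_Theory"
begin

abbreviation GL :: "nat \<Rightarrow> complex mat monoid" where
  "GL d \<equiv> units_of (ring_mat TYPE(complex) d ())"

definition irreducible_representation ::
    "('a, 'b) monoid_scheme \<Rightarrow> nat \<Rightarrow> ('a \<Rightarrow> complex mat) \<Rightarrow> bool" where
  "irreducible_representation G d R \<longleftrightarrow>
     d > 0 \<and> R \<in> hom G (GL d) \<and>
     (\<forall>W. VectorSpace.subspace class_ring W (module_vec TYPE(complex) d) \<longrightarrow>
          (\<forall>g \<in> carrier G. \<forall>w \<in> W. R g *\<^sub>v w \<in> W) \<longrightarrow>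
          W = {0\<^sub>v d} \<or> W = carrier_vec d)"

definition character_of ::
    "('a, 'b) monoid_scheme \<Rightarrow> ('a \<Rightarrow> complex mat) \<Rightarrow> 'a \<Rightarrow> complex" where
  "character_of G R = (\<lambda>g \<in> carrier G. sum_list (diag_mat (R g)))"

text \<open>Characters are functions on \<open>carrier G\<close>, hence \<open>undefined\<close> outside it.\<close>

definition Irr :: "('a, 'b) monoid_scheme \<Rightarrow> ('a \<Rightarrow> complex) set" where
  "Irr G = {character_of G R | d R. irreducible_representation G d R}"

definition cd :: "('a, 'b) monoid_scheme \<Rightarrow> nat set" where
  "cd G = {m. \<exists>\<chi> \<in> Irr G. \<chi> \<one>\<^bsub>G\<^esub> = of_nat m}"

definition degree_primes :: "('a, 'b) monoid_scheme \<Rightarrow> nat set" where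
  "degree_primes G = {p. prime p \<and> (\<exists>r \<in> cd G. p dvd r)}"

text \<open>Simple undirected graphs are loop-free symmetric digraphs without parallel arcs:
  an edge is a pair of opposite arcs.\<close>

definition character_degree_graph :: "('a, 'b) monoid_scheme \<Rightarrow> nat pair_pre_digraph" where
  "character_degree_graph G =
     \<lparr> pverts = degree_primes G,
       parcs = {(p, q). p \<in> degree_primes G \<and> q \<in> degree_primes G \<and> p \<noteq> q \<and>
                        (\<exists>r \<in> cd G. p * q dvd r)} \<rparr>"

text \<open>As arcs come in opposite pairs, the degree of a vertex is its out-degree.\<close>

definition regular_graph :: "'a pair_pre_digraph \<Rightarrow> nat \<Rightarrow> bool" where
  "regular_graph \<Gamma> k \<longleftrightarrow> (\<forall>v \<in> pverts \<Gamma>. out_degree \<Gamma> v = k)"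

text \<open>The library function \<open>\<mu>\<close> is the weighted distance; unit weights give the
  length of a shortest path. It is infinite, hence sent to 0 by \<open>real_of_ereal\<close>, between
  different components, so everything below is meaningful for connected graphs only.\<close>

definition graph_distance :: "'a pair_pre_digraph \<Rightarrow> 'a \<Rightarrow> 'a \<Rightarrow> real" where
  "graph_distance \<Gamma> u v = real_of_ereal (wf_digraph.\<mu> \<Gamma> (\<lambda>_. 1) u v)"

definition transmission :: "'a pair_pre_digraph \<Rightarrow> 'a \<Rightarrow> real" where
  "transmission \<Gamma> v = (\<Sum>u \<in> pverts \<Gamma>. graph_distance \<Gamma> u v)"

text \<open>Matrices are indexed by \<open>0, 1, \<dots>\<close>; the \<open>i\<close>-th row and column belong to the
  \<open>i\<close>-th vertex in increasing order. The order does not affect the spectrum.\<close>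

definition vertex_matrix ::
    "'a::linorder pair_pre_digraph \<Rightarrow> ('a \<Rightarrow> 'a \<Rightarrow> real) \<Rightarrow> real mat" where
  "vertex_matrix \<Gamma> f =
     (let vs = sorted_list_of_set (pverts \<Gamma>)
      in mat (length vs) (length vs) (\<lambda>(i, j). f (vs ! i) (vs ! j)))"

definition distance_matrix :: "'a::linorder pair_pre_digraph \<Rightarrow> real mat" where
  "distance_matrix \<Gamma> = vertex_matrix \<Gamma> (graph_distance \<Gamma>)"

definition transmission_matrix :: "'a::linorder pair_pre_digraph \<Rightarrow> real mat" where
  "transmission_matrix \<Gamma> = vertex_matrix \<Gamma> (\<lambda>u v. if u = v then transmission \<Gamma> v else 0)"

definition distance_laplacian :: "'a::linorder pair_pre_digraph \<Rightarrow> real mat" where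
  "distance_laplacian \<Gamma> = transmission_matrix \<Gamma> - distance_matrix \<Gamma>"

text \<open>The two-row array as the set of its columns (eigenvalue, multiplicity). The matrix is
  real symmetric, so all its eigenvalues are real and their algebraic and geometric
  multiplicities agree.\<close>

definition distance_laplacian_spectrum :: "'a::linorder pair_pre_digraph \<Rightarrow> (real \<times> nat) set" where
  "distance_laplacian_spectrum \<Gamma> =
     (\<lambda>k. (k, Polynomial.order k (char_poly (distance_laplacian \<Gamma>)))) `
       spectrum (distance_laplacian \<Gamma>)"

end

theory Submission
  imports Defs
begin

text \<open>An \<open>(n - 2)\<close>-regular graph on \<open>n\<close> vertices is
  \<open>K\<^sub>n\<close> minus a perfect matching \<open>\<tau>\<close>. For \<open>n \<ge> 4\<close> matched vertices have a common neighbour, so all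
  distances are at most 2, all transmissions are \<open>n\<close>, and the distance Laplacian is
  \<open>(n + 1) I - J - P\<close>, where \<open>J\<close> is the all-ones matrix and \<open>P\<close> the permutation matrix of \<open>\<tau>\<close>.
  It is diagonalised by the all-ones vector (eigenvalue 0), the differences of the indicator
  vectors of two matched pairs (eigenvalue \<open>n\<close>), and the vectors \<open>e\<^sub>v - e\<^bsub>\<tau> v\<^esub>\<close>
  (eigenvalue \<open>n + 2\<close>).\<close>

section \<open>Distances and transmissions in \<open>K_n\<close> minus a perfect matching\<close>

locale cocktail_party =
  fixes \<Gamma> :: "'a::linorder pair_pre_digraph" and \<tau> :: "'a \<Rightarrow> 'a" and n :: nat
  assumes finite_verts: "finite (pverts \<Gamma>)"
    and card_verts: "card (pverts \<Gamma>) = n"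
    and n_ge_4: "n \<ge> 4"
    and tau_in: "v \<in> pverts \<Gamma> \<Longrightarrow> \<tau> v \<in> pverts \<Gamma>"
    and tau_neq: "v \<in> pverts \<Gamma> \<Longrightarrow> \<tau> v \<noteq> v"
    and tau_tau: "v \<in> pverts \<Gamma> \<Longrightarrow> \<tau> (\<tau> v) = v"
    and arcs_iff: "(u, v) \<in> parcs \<Gamma> \<longleftrightarrow> u \<in> pverts \<Gamma> \<and> v \<in> pverts \<Gamma> \<and> v \<noteq> u \<and> v \<noteq> \<tau> u"
begin

lemma tau_eq_iff: "u \<in> pverts \<Gamma> \<Longrightarrow> v \<in> pverts \<Gamma> \<Longrightarrow> \<tau> u = \<tau> v \<longleftrightarrow> u = v"
  by (metis tau_tau)

lemma eq_tau_iff: "u \<in> pverts \<Gamma> \<Longrightarrow> v \<in> pverts \<Gamma> \<Longrightarrow> u = \<tau> v \<longleftrightarrow> v = \<tau> u"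
  by (metis tau_tau)

sublocale pair_wf_digraph \<Gamma>
  by unfold_locales (auto simp: arcs_iff)

text \<open>With at least 4 vertices there is one outside the pair \<open>{u, \<tau> u}\<close>; its
  own partner is neither \<open>u\<close> nor \<open>\<tau> u\<close>, so it is adjacent to
  both.\<close>

lemma common_neighbour:
  assumes "u \<in> pverts \<Gamma>"
  obtains w where "(u, w) \<in> parcs \<Gamma>" "(w, \<tau> u) \<in> parcs \<Gamma>"
proof -
  have "card {u, \<tau> u} \<le> 2"
    by (simp add: card_insert_if)
  then have "\<not> pverts \<Gamma> \<subseteq> {u, \<tau> u}"
    using card_mono[of "{u, \<tau> u}" "pverts \<Gamma>"] card_verts n_ge_4 by auto
  then obtain w where "w \<in> pverts \<Gamma>" "w \<noteq> u" "w \<noteq> \<tau> u"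
    by blast
  with assms that show thesis
    by (metis arcs_iff tau_in tau_tau)
qed

text \<open>Two vertices are equal, adjacent or matched, and matched ones are joined through a
  common neighbour.\<close>

lemma connected: "Digraph_Component.connected \<Gamma>"
proof -
  have "(u, v) \<in> rtrancl_on (pverts \<Gamma>) ((parcs \<Gamma>)\<^sup>s)"
    if uv: "u \<in> pverts \<Gamma>" "v \<in> pverts \<Gamma>" for u v
  proof -
    have *: "(a, b) \<in> rtrancl_on (pverts \<Gamma>) ((parcs \<Gamma>)\<^sup>s)" if "(a, b) \<in> parcs \<Gamma>" for a b
      using that wellformed'[OF that]
      by (intro rtrancl_on_into_rtrancl_on[OF rtrancl_on_refl]) (simp_all add: symcl_def)
    consider "u = v" | "v = \<tau> u" | "(u, v) \<in> parcs \<Gamma>"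
      using uv by (auto simp: arcs_iff)
    then show ?thesis
    proof cases
      case 1
      then show ?thesis using uv by simp
    next
      case 2
      then show ?thesis
        by (metis * common_neighbour uv(1) rtrancl_on_trans)
    next
      case 3
      then show ?thesis by (rule *)
    qed
  qed
  moreover have "pverts \<Gamma> \<noteq> {}"
    using card_verts n_ge_4 by auto
  ultimately show ?thesis
    by (simp add: connected_conv)
qed

text \<open>Under unit weights the cost of a walk is its length, so exhibiting one shortest walk
  determines the infimum that defines the distance.\<close>

lemma graph_distance_eq_length:
  assumes "awalk u p v" and "\<And>q. awalk u q v \<Longrightarrow> length p \<le> length q"
  shows "graph_distance \<Gamma> u v = length p"
proof -
  have cost: "awalk_cost (\<lambda>_. 1) q = length q" for q :: "('a \<times> 'a) list"
    by (induction q) auto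
  have "\<mu> (\<lambda>_. 1) u v = ereal (length p)"
    unfolding \<mu>_def cost using assms
    by (intro antisym INF_greatest INF_lower2[of p]) auto
  then show ?thesis
    by (simp add: graph_distance_def)
qed

lemma graph_distance:
  assumes uv: "u \<in> pverts \<Gamma>" "v \<in> pverts \<Gamma>"
  shows "graph_distance \<Gamma> u v = (if u = v then 0 else if u = \<tau> v then 2 else 1)"
proof -
  consider "u = v" | "v = \<tau> u" "u \<noteq> v" | "(u, v) \<in> parcs \<Gamma>" "u \<noteq> v" "u \<noteq> \<tau> v"
    using uv by (auto simp: arcs_iff eq_tau_iff)
  then show ?thesis
  proof cases
    case 1
    then have "awalk u [] v"
      using uv by (simp add: awalk_Nil_iff)
    from graph_distance_eq_length[OF this] 1 show ?thesis by simp
  next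
    case 2
    obtain w where w: "(u, w) \<in> parcs \<Gamma>" "(w, v) \<in> parcs \<Gamma>"
      using common_neighbour uv(1) 2 by metis
    then have "awalk u [(u, w), (w, v)] v"
      using uv by (simp add: awalk_simps)
    moreover have "length [(u, w), (w, v)] \<le> length q" if "awalk u q v" for q
    proof (rule ccontr)
      assume "\<not> ?thesis"
      \<comment> \<open>The empty walk would force \<open>u = v\<close>, and a single arc would join
        two matched vertices.\<close>
      then consider "q = []" | e where "q = [e]"
        by (cases q; cases "tl q") auto
      then show False
        using that 2 by cases (auto simp: awalk_simps arcs_iff)
    qed
    ultimately have "graph_distance \<Gamma> u v = length [(u, w), (w, v)]"
      by (rule graph_distance_eq_length)
    then show ?thesis using 2 uv by (simp add: tau_tau)
  next
    case 3
    then have "awalk u [(u, v)] v"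
      using uv by (simp add: awalk_simps)
    moreover have "length [(u, v)] \<le> length q" if "awalk u q v" for q
      using that 3 by (cases q) (auto simp: awalk_simps)
    ultimately have "graph_distance \<Gamma> u v = length [(u, v)]"
      by (rule graph_distance_eq_length)
    then show ?thesis using 3 by simp
  qed
qed

text \<open>Counting distance 1 to all \<open>n\<close> vertices is 1 too much at \<open>v\<close>
  itself and 1 too little at \<open>\<tau> v\<close>; the two corrections cancel.\<close>

lemma transmission:
  assumes "v \<in> pverts \<Gamma>"
  shows "transmission \<Gamma> v = n"
proof -
  have "transmission \<Gamma> v
      = (\<Sum>u\<in>pverts \<Gamma>. 1 - (if u = v then 1 else 0) + (if u = \<tau> v then 1 else 0))"
    unfolding transmission_def
    using assms tau_neq by (intro sum.cong) (auto simp: graph_distance)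
  also have "\<dots> = n"
    using assms tau_in finite_verts card_verts by (simp add: sum.distrib sum_subtractf)
  finally show ?thesis .
qed

section \<open>Diagonalisation of the distance Laplacian\<close>

lemma matching_enumeration:
  obtains x where "inj_on x {..<n div 2}" "x ` {..<n div 2} \<inter> \<tau> ` x ` {..<n div 2} = {}"
    "pverts \<Gamma> = x ` {..<n div 2} \<union> \<tau> ` x ` {..<n div 2}" "n = 2 * (n div 2)"
proof -
  \<comment> \<open>The linear order singles out the smaller vertex of each matched pair as its
    representative.\<close>
  define S where "S = {v \<in> pverts \<Gamma>. v < \<tau> v}"
  have fin: "finite S"
    using finite_verts by (simp add: S_def)
  have disj: "S \<inter> \<tau> ` S = {}"
    by (auto simp: S_def tau_tau)
  have un: "pverts \<Gamma> = S \<union> \<tau> ` S"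
  proof (intro equalityI subsetI)
    fix v assume v: "v \<in> pverts \<Gamma>"
    then have "v \<in> S \<or> \<tau> v \<in> S"
      using tau_neq[OF v] by (auto simp: S_def tau_tau tau_in)
    then show "v \<in> S \<union> \<tau> ` S"
      using tau_tau[OF v] by (metis UnCI imageI)
  qed (auto simp: S_def tau_in)
  have "inj_on \<tau> S"
    by (rule inj_onI) (simp add: S_def tau_eq_iff)
  then have card: "n = 2 * card S"
    using card_Un_disjoint[OF fin _ disj] fin card_verts un by (simp add: card_image)
  obtain x where "bij_betw x {..<card S} S"
    using ex_bij_betw_nat_finite[OF fin] by (auto simp: atLeast0LessThan)
  with card that[of x] un disj show thesis
    by (simp add: bij_betw_def)
qed

text \<open>Entrywise form of \<open>(n + 1) I - J - P\<close>: the entries are \<open>n\<close> on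
  the diagonal, -2 at matched pairs and -1 elsewhere.\<close>

lemma distance_laplacian_index:
  defines "vs \<equiv> sorted_list_of_set (pverts \<Gamma>)"
  shows "distance_laplacian \<Gamma> = mat n n (\<lambda>(i, j).
    (real n + 1) * of_bool (vs ! i = vs ! j) - 1 - of_bool (vs ! i = \<tau> (vs ! j)))"
proof -
  have len: "length vs = n"
    using card_verts by (simp add: vs_def)
  have vs: "vs ! i \<in> pverts \<Gamma>" if "i < n" for i
    using that len finite_verts nth_mem[of i vs] by (simp add: vs_def)
  show ?thesis
    unfolding distance_laplacian_def transmission_matrix_def distance_matrix_def
      vertex_matrix_def Let_def vs_def[symmetric] len
    by (rule eq_matI) (auto simp: vs graph_distance transmission dest: tau_neq[OF vs])
qed

text \<open>An explicit eigenbasis \<open>Q\<close> with explicit inverse \<open>R\<close> makes the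
  matrix similar to the diagonal matrix \<open>D\<close>, whose characteristic polynomial is a
  product of linear factors.\<close>

lemma char_poly_distance_laplacian:
  "char_poly (distance_laplacian \<Gamma>)
    = [:0, 1:] * [:- real n, 1:] ^ (n div 2 - 1) * [:- (real n + 2), 1:] ^ (n div 2)"
proof -
  define m where "m = n div 2"
  obtain x where inj: "inj_on x {..<m}" and disj: "x ` {..<m} \<inter> \<tau> ` x ` {..<m} = {}"
    and verts: "pverts \<Gamma> = x ` {..<m} \<union> \<tau> ` x ` {..<m}" and n: "n = 2 * m"
    unfolding m_def using matching_enumeration by metis
  have m: "m \<ge> 2"
    using n n_ge_4 by simp
  have x_in: "x j \<in> pverts \<Gamma>" if "j < m" for j
    using verts that by blast
  have x_eq: "x j = x k \<longleftrightarrow> j = k" "\<tau> (x j) = \<tau> (x k) \<longleftrightarrow> j = k"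
    "x j \<noteq> \<tau> (x k)" "\<tau> (x j) \<noteq> x k" if "j < m" "k < m" for j k
    using that inj disj x_in tau_eq_iff by (auto simp: inj_on_eq_iff)
  have sum_verts: "(\<Sum>v\<in>pverts \<Gamma>. f v) = (\<Sum>j<m. f (x j) + f (\<tau> (x j)))" for f :: "'a \<Rightarrow> real"
  proof -
    have "inj_on \<tau> (x ` {..<m})"
      by (rule inj_onI) (metis verts UnCI tau_eq_iff)
    then show ?thesis
      unfolding verts by (simp add: sum.union_disjoint disj sum.reindex inj sum.distrib)
  qed

  define vs where "vs = sorted_list_of_set (pverts \<Gamma>)"
  have len: "length vs = n"
    using card_verts by (simp add: vs_def)
  have set_vs: "set vs = pverts \<Gamma>" and dist: "distinct vs"
    using finite_verts by (simp_all add: vs_def)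
  have vs: "vs ! i \<in> pverts \<Gamma>" if "i < n" for i
    using that len set_vs nth_mem by metis
  have sum_index: "(\<Sum>i<n. f (vs ! i)) = (\<Sum>v\<in>pverts \<Gamma>. f v)" for f :: "'a \<Rightarrow> real"
    using bij_betw_nth[OF dist refl refl] len set_vs
    by (intro sum.reindex_bij_betw) simp

  define \<delta> where "\<delta> v w = (of_bool (v = w) :: real)" for v w :: 'a
  \<comment> \<open>For \<open>k < m\<close>, the functions \<open>s _ k\<close> span the functions
    invariant under \<open>\<tau>\<close>, and the \<open>a _ k\<close> span those that change
    sign.\<close>
  define s where "s v k = \<delta> v (x k) + \<delta> v (\<tau> (x k))" for v k
  define a where "a v k = \<delta> v (x k) - \<delta> v (\<tau> (x k))" for v k
  \<comment> \<open>\<open>q _ l\<close> is the \<open>l\<close>-th eigenvector, \<open>r\<close> is the dual basis and \<open>d\<close> lists the eigenvalues\<close>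
  define q where "q v l = (if l = 0 then 1 else if l < m then s v l - s v 0 else a v (l - m))" for v l
  define r where
    "r l v = (if l = 0 then 1 / n else if l < m then s v l / 2 - 1 / n else a v (l - m) / 2)" for v l
  define d where "d l = (if l = 0 then 0 else if l < m then real n else real n + 2)" for l

  have s_x: "s (x j) k = of_bool (j = k)" "s (\<tau> (x j)) k = of_bool (j = k)"
    and a_x: "a (x j) k = of_bool (j = k)" "a (\<tau> (x j)) k = - of_bool (j = k)"
    if "j < m" "k < m" for j k
    using that by (simp_all add: s_def a_def \<delta>_def x_eq)

  define M where "M = distance_laplacian \<Gamma>"
  define Q where "Q = mat n n (\<lambda>(i, l). q (vs ! i) l)"
  define R where "R = mat n n (\<lambda>(l, i). r l (vs ! i))"
  define D where "D = mat n n (\<lambda>(i, j). if i = j then d j else 0)"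
  have carr: "M \<in> carrier_mat n n" "Q \<in> carrier_mat n n" "R \<in> carrier_mat n n" "D \<in> carrier_mat n n"
    by (simp_all add: M_def distance_laplacian_index Q_def R_def D_def)

  \<comment> \<open>Biorthogonality. For \<open>0 < k < m\<close>, \<open>s _ k / 2\<close> alone
    pairs to 1 with the all-ones vector; the term \<open>- 1 / n\<close> in \<open>r\<close> cancels
    this and pairs to 0 with the differences \<open>s _ l - s _ 0\<close>.\<close>
  have "(\<Sum>v\<in>pverts \<Gamma>. r k v * q v l) = of_bool (k = l)" if kl: "k < n" "l < n" for k l
  proof -
    define e where "e k j = (of_bool (j = k) :: real)" for k j :: nat
    have e_sum: "(\<Sum>j<m. e k j) = 1" "(\<Sum>j<m. e k j * e l j) = of_bool (k = l)"
      if "k < m" for k l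
      using that by (auto simp: e_def of_bool_def sum.delta if_distrib[of "\<lambda>t. t * _"] cong: if_cong)
    have "(\<Sum>v\<in>pverts \<Gamma>. r k v * q v l)
        = (\<Sum>j<m. r k (x j) * q (x j) l + r k (\<tau> (x j)) * q (\<tau> (x j)) l)"
      by (rule sum_verts)
    also have "\<dots> = (\<Sum>j<m.
        (if k = 0 then 1 / n else if k < m then e k j / 2 - 1 / n else e (k - m) j / 2)
        * (if l = 0 then 1 else if l < m then e l j - e 0 j else e (l - m) j)
      + (if k = 0 then 1 / n else if k < m then e k j / 2 - 1 / n else - e (k - m) j / 2)
        * (if l = 0 then 1 else if l < m then e l j - e 0 j else - e (l - m) j))"
      using kl n m by (intro sum.cong refl) (simp add: q_def r_def s_x a_x e_def)
    also have "\<dots> = of_bool (k = l)"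
    proof -
      have "k - m < m" "l - m < m"
        using kl n m by auto
      then show ?thesis
        using kl n m
        by (cases "k = 0"; cases "k < m"; cases "l = 0"; cases "l < m")
          (simp_all add: algebra_simps sum.distrib sum_subtractf e_sum add_divide_distrib
            diff_divide_distrib eq_diff_iff
            flip: sum_distrib_left sum_distrib_right sum_divide_distrib)
    qed
    finally show ?thesis .
  qed
  then have RQ: "R * Q = 1\<^sub>m n"
    by (intro eq_matI)
      (auto simp: R_def Q_def scalar_prod_def atLeast0LessThan sum_index[of "\<lambda>v. r _ v * q v _"])
  then have QR: "Q * R = 1\<^sub>m n"
    using mat_mult_left_right_inverse carr by blast

  \<comment> \<open>Applied to a column, \<open>(n + 1) I - J - P\<close> multiplies by
    \<open>n + 1\<close>, then subtracts the column sum and the value at the partner. The column sum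
    vanishes unless \<open>l = 0\<close>, and the value at the partner is \<open>q v l\<close> for
    \<open>l < m\<close> and \<open>- q v l\<close> otherwise.\<close>
  have eigen: "(\<Sum>w\<in>pverts \<Gamma>. ((real n + 1) * of_bool (v = w) - 1 - of_bool (v = \<tau> w)) * q w l)
      = q v l * d l"
    if v: "v \<in> pverts \<Gamma>" and l: "l < n" for v l
  proof -
    have "(\<Sum>w\<in>pverts \<Gamma>. ((real n + 1) * of_bool (v = w) - 1 - of_bool (v = \<tau> w)) * q w l)
        = (\<Sum>w\<in>pverts \<Gamma>. (if v = w then (real n + 1) * q w l else 0) - q w l
            - (if \<tau> v = w then q w l else 0))"
      using eq_tau_iff[OF v] by (intro sum.cong) (auto simp: algebra_simps)
    also have "\<dots> = (real n + 1) * q v l - (\<Sum>w\<in>pverts \<Gamma>. q w l) - q (\<tau> v) l"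
      using v tau_in finite_verts by (simp add: sum_subtractf sum.delta')
    also have "(\<Sum>w\<in>pverts \<Gamma>. q w l) = (if l = 0 then real n else 0)"
      unfolding sum_verts using l n m
      by (cases "l = 0"; cases "l < m")
        (simp_all add: q_def s_x a_x sum.distrib sum_subtractf of_bool_def sum.delta
          flip: sum_distrib_left cong: sum.cong_simp)
    also have "q (\<tau> v) l = (if l < m then q v l else - q v l)"
    proof -
      have "\<delta> (\<tau> v) (x k) = \<delta> v (\<tau> (x k))" "\<delta> (\<tau> v) (\<tau> (x k)) = \<delta> v (x k)" if "k < m" for k
        using tau_eq_iff[OF v x_in[OF that]] eq_tau_iff[OF v x_in[OF that]]
        by (auto simp: \<delta>_def)
      then show ?thesis
        using l n m by (auto simp: q_def s_def a_def)
    qed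
    finally show ?thesis
      using l n m by (auto simp: q_def d_def algebra_simps)
  qed
  have MQ: "M * Q = Q * D"
  proof (rule eq_matI)
    fix i l assume "i < dim_row (Q * D)" "l < dim_col (Q * D)"
    then have il: "i < n" "l < n"
      using carr by auto
    have "(M * Q) $$ (i, l) = (\<Sum>k<n. ((real n + 1) * of_bool (vs ! i = vs ! k) - 1
        - of_bool (vs ! i = \<tau> (vs ! k))) * q (vs ! k) l)"
      using il by (simp add: M_def distance_laplacian_index Q_def scalar_prod_def
          atLeast0LessThan flip: vs_def)
    also have "\<dots> = q (vs ! i) l * d l"
      by (subst sum_index) (rule eigen[OF vs[OF il(1)] il(2)])
    also have "\<dots> = (Q * D) $$ (i, l)"
      using il by (simp add: Q_def D_def scalar_prod_def if_distrib sum.delta cong: if_cong)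
    finally show "(M * Q) $$ (i, l) = (Q * D) $$ (i, l)" .
  qed (use carr in auto)
  have "M = M * (Q * R)"
    using QR carr by simp
  also have "\<dots> = Q * D * R"
    using MQ carr by (metis assoc_mult_mat)
  finally have "similar_mat M D"
    using carr QR RQ by (intro similar_matI[of _ _ Q R n]) auto
  then have "char_poly M = char_poly D"
    by (rule char_poly_similar)
  also have "\<dots> = (\<Prod>a\<leftarrow>diag_mat D. [:- a, 1:])"
    using carr by (intro char_poly_upper_triangular) (auto simp: D_def upper_triangular_def)
  also have "\<dots> = (\<Prod>l=0..<n. [:- d l, 1:])"
  proof -
    have "diag_mat D = map d [0..<n]"
      by (auto simp: diag_mat_def D_def)
    then show ?thesis
      by (simp add: o_def flip: prod.distinct_set_conv_list)
  qed
  also have "\<dots> = [:0, 1:] * [:- real n, 1:] ^ (m - 1) * [:- (real n + 2), 1:] ^ m"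
  proof -
    \<comment> \<open>The indices are grouped by eigenvalue; the last block has
      \<open>n - m = m\<close> elements.\<close>
    have "{0..<n} = {0} \<union> {1..<m} \<union> {m..<n}"
      using n m by auto
    then have "(\<Prod>l=0..<n. f l) = f 0 * (\<Prod>l=1..<m. f l) * (\<Prod>l=m..<n. f l)"
      for f :: "nat \<Rightarrow> real poly"
      using m by (simp add: prod.union_disjoint mult.assoc)
    then have "(\<Prod>l=0..<n. [:- d l, 1:]) =
        [:- d 0, 1:] * (\<Prod>l=1..<m. [:- d l, 1:]) * (\<Prod>l=m..<n. [:- d l, 1:])" .
    also have "(\<Prod>l=1..<m. [:- d l, 1:]) = [:- real n, 1:] ^ (m - 1)"
      by (simp add: d_def)
    also have "(\<Prod>l=m..<n. [:- d l, 1:]) = [:- (real n + 2), 1:] ^ m"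
      using n m by (simp add: d_def)
    finally show ?thesis
      by (simp add: d_def)
  qed
  finally show ?thesis
    by (simp add: M_def m_def)
qed

lemma distance_laplacian_spectrum:
  "distance_laplacian_spectrum \<Gamma> = {(0, 1), (real n + 2, n div 2), (real n, n div 2 - 1)}"
proof -
  let ?A = "distance_laplacian \<Gamma>"
  have A: "?A \<in> carrier_mat n n"
    by (simp add: distance_laplacian_index)
  \<comment> \<open>This keeps the exponent \<open>n div 2 - 1\<close> positive, so that
    \<open>n\<close> really is a root.\<close>
  have m: "n div 2 \<ge> 2"
    using n_ge_4 by simp
  have "spectrum ?A = {0, real n + 2, real n}"
    unfolding spectrum_def using m
    by (auto simp: eigenvalue_root_char_poly[OF A] char_poly_distance_laplacian)
  moreover have ord: "Polynomial.order k (char_poly ?A)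
      = (if k = 0 then 1 else 0) + (if k = real n then n div 2 - 1 else 0)
        + (if k = real n + 2 then n div 2 else 0)" for k
  proof -
    have pow: "Polynomial.order k ([:- c, 1:] ^ j) = (if k = c then j else 0)" for c :: real and j
      by (auto simp: order_power_n_n intro: order_0I)
    have "Polynomial.order k (f * g * h)
        = Polynomial.order k f + Polynomial.order k g + Polynomial.order k h"
      if "f \<noteq> 0" "g \<noteq> 0" "h \<noteq> 0" for f g h :: "real poly"
      using that by (simp add: order_mult)
    then have "Polynomial.order k (char_poly ?A) = Polynomial.order k [:0, 1:]
        + Polynomial.order k ([:- real n, 1:] ^ (n div 2 - 1))
        + Polynomial.order k ([:- (real n + 2), 1:] ^ (n div 2))"
      unfolding char_poly_distance_laplacian by this simp_all
    moreover have "Polynomial.order k [:0, 1:] = (if k = 0 then 1 else 0)"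
      using pow[of 0 1] by simp
    ultimately show ?thesis
      by (simp only: pow)
  qed
  \<comment> \<open>The numbers 0, \<open>n\<close> and \<open>n + 2\<close> are distinct, so at
    each of them only one summand of \<open>ord\<close> survives.\<close>
  ultimately show ?thesis
    unfolding distance_laplacian_spectrum_def using n_ge_4 by auto
qed

end

section \<open>Extracting the perfect matching from regularity\<close>

lemma regular_cocktail_party:
  fixes \<Gamma> :: "'a::linorder pair_pre_digraph"
  assumes "pair_graph \<Gamma>" and n: "n \<ge> 4" "card (pverts \<Gamma>) = n"
    and reg: "regular_graph \<Gamma> (n - 2)"
  obtains \<tau> where "cocktail_party \<Gamma> \<tau> n"
proof -
  interpret pair_graph \<Gamma> by fact
  let ?V = "pverts \<Gamma>"
  have sym: "(u, v) \<in> parcs \<Gamma> \<longleftrightarrow> (v, u) \<in> parcs \<Gamma>" for u v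
    using arcs_symmetric by blast
  \<comment> \<open>Of the \<open>n - 1\<close> vertices other than \<open>v\<close>, exactly
    \<open>n - 2\<close> are neighbours; the one left over becomes \<open>\<tau> v\<close>.\<close>
  have "\<exists>w. ?V - {v} - {u. (v, u) \<in> parcs \<Gamma>} = {w}" if v: "v \<in> ?V" for v
  proof -
    let ?N = "{u. (v, u) \<in> parcs \<Gamma>}"
    have "out_arcs \<Gamma> v = Pair v ` ?N"
      by (auto simp: out_arcs_def)
    then have "card ?N = n - 2"
      using bspec[OF reg[unfolded regular_graph_def] v]
      by (simp add: out_degree_def card_image inj_on_def)
    moreover have "?N \<subseteq> ?V - {v}"
      using pair_no_loops wellformed' by fastforce
    ultimately have "card (?V - {v} - ?N) = 1"
      using n v pair_finite_verts by (simp add: card_Diff_subset finite_subset)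
    then show ?thesis
      by (auto simp: card_1_singleton_iff)
  qed
  then obtain \<tau> where \<tau>: "\<And>v. v \<in> ?V \<Longrightarrow> ?V - {v} - {u. (v, u) \<in> parcs \<Gamma>} = {\<tau> v}"
    by metis
  have iff: "(v, u) \<notin> parcs \<Gamma> \<and> u \<noteq> v \<longleftrightarrow> u = \<tau> v" if "v \<in> ?V" "u \<in> ?V" for u v
    using \<tau>[OF that(1)] that by blast
  have in_V: "\<tau> v \<in> ?V" if "v \<in> ?V" for v
    using \<tau>[OF that] by blast
  have "cocktail_party \<Gamma> \<tau> n"
  proof
    \<comment> \<open>Non-adjacency is symmetric, so \<open>v\<close> is the unique non-neighbour of
      \<open>\<tau> v\<close>.\<close>
    show "\<tau> (\<tau> v) = v" if v: "v \<in> ?V" for v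
      using iff[OF v in_V[OF v]] iff[OF in_V[OF v] v] sym by auto
    show "(u, v) \<in> parcs \<Gamma> \<longleftrightarrow> u \<in> ?V \<and> v \<in> ?V \<and> v \<noteq> u \<and> v \<noteq> \<tau> u" for u v
      using iff[of u v] pair_no_loops[of "(u, v)"] wellformed'[of u v] by auto
    show "\<tau> v \<noteq> v" if v: "v \<in> ?V" for v
      using iff[OF v in_V[OF v]] by simp
  qed (use n in_V pair_finite_verts in auto)
  then show thesis by (rule that)
qed

theorem corollary3p5:
  fixes G :: "('a, 'b) monoid_scheme" and n :: nat
  assumes "n \<ge> 4" and "even n"
    and "group G" and "finite (carrier G)" and "solvable G"
    and "card (pverts (character_degree_graph G)) = n"
    and "regular_graph (character_degree_graph G) (n - 2)"
  shows "Digraph_Component.connected (character_degree_graph G) \<and>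
         distance_laplacian_spectrum (character_degree_graph G) =
           {(0, 1), (real n + 2, n div 2), (real n, n div 2 - 1)}"
proof -
  let ?\<Gamma> = "character_degree_graph G"
  \<comment> \<open>An infinite set has cardinality 0 by convention, which \<open>n \<ge> 4\<close>
    excludes.\<close>
  have fin: "finite (pverts ?\<Gamma>)"
    using assms by (intro card_ge_0_finite) simp
  have "parcs ?\<Gamma> \<subseteq> pverts ?\<Gamma> \<times> pverts ?\<Gamma>"
    by (auto simp: character_degree_graph_def)
  then have "finite (parcs ?\<Gamma>)"
    using fin finite_subset by blast
  with fin have "pair_graph ?\<Gamma>"
    by unfold_locales
      (auto simp: character_degree_graph_def symmetric_def sym_def mult.commute)
  then obtain \<tau> where "cocktail_party ?\<Gamma> \<tau> n"
    using regular_cocktail_party assms by metis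
  then interpret cocktail_party ?\<Gamma> \<tau> n .
  show ?thesis
    using connected distance_laplacian_spectrum by blast
qed

end
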